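(* Let $R$ be an integral domain. If $\psi:(\mathcal W(R),+,* )\to(\mathcal W(R),+,\star)$ is a morphism of $R$-algebras, then $\psi$ is not injective.
   Context: $\mathcal W(R)$ is the set of linear recurrent sequences $(a_n)_{n\ge0}$ in $R$, i.e. sequences for which there exist $N\ge0$ and $h_1,\dots,h_N\in R$ with $a_n=\sum_{i=1}^{N}h_ia_{n-i}$ for all $n\ge N$. Operations: componentwise sum $(\mathbf a+\mathbf b)_n=a_n+b_n$; convolution (Cauchy) product $(\mathbf a*\mathbf b)_n=\sum_{i=0}^na_ib_{n-i}$; Hurwitz product $(\mathbf a\star\mathbf b)_n=\sum_{i=0}^n\binom{n}{i}a_ib_{n-i}$. *)

theory Defs
  imports Complex_Main "HOL-Algebra.Module"
begin

definition linrec_seqs :: "(nat \<Rightarrow> 'a::comm_ring_1) set" where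
  "linrec_seqs = {a. \<exists>(N::nat) h. \<forall>n\<ge>N. a n = (\<Sum>i=1..N. h i * a (n - i))}"

definition seq_add :: "(nat \<Rightarrow> 'a::comm_ring_1) \<Rightarrow> (nat \<Rightarrow> 'a) \<Rightarrow> nat \<Rightarrow> 'a" where
  "seq_add a b = (\<lambda>n. a n + b n)"

definition seq_scale :: "'a::comm_ring_1 \<Rightarrow> (nat \<Rightarrow> 'a) \<Rightarrow> nat \<Rightarrow> 'a" where
  "seq_scale r a = (\<lambda>n. r * a n)"

definition seq_conv :: "(nat \<Rightarrow> 'a::comm_ring_1) \<Rightarrow> (nat \<Rightarrow> 'a) \<Rightarrow> nat \<Rightarrow> 'a" where
  "seq_conv a b = (\<lambda>n. \<Sum>i=0..n. a i * b (n - i))"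

definition seq_hurwitz :: "(nat \<Rightarrow> 'a::comm_ring_1) \<Rightarrow> (nat \<Rightarrow> 'a) \<Rightarrow> nat \<Rightarrow> 'a" where
  "seq_hurwitz a b = (\<lambda>n. \<Sum>i=0..n. of_nat (n choose i) * a i * b (n - i))"

text \<open>The sequence \<open>(1, 0, 0, \<dots>)\<close> is the identity for both products.\<close>

definition seq_one :: "nat \<Rightarrow> 'a::comm_ring_1" where
  "seq_one = (\<lambda>n. if n = 0 then 1 else 0)"

definition linrec_conv_algebra :: "('a::comm_ring_1, nat \<Rightarrow> 'a) module" where
  "linrec_conv_algebra =
     \<lparr>carrier = linrec_seqs, monoid.mult = seq_conv, one = seq_one,
      zero = (\<lambda>_. 0), add = seq_add, smult = seq_scale\<rparr>"

definition linrec_hurwitz_algebra :: "('a::comm_ring_1, nat \<Rightarrow> 'a) module" where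
  "linrec_hurwitz_algebra =
     \<lparr>carrier = linrec_seqs, monoid.mult = seq_hurwitz, one = seq_one,
      zero = (\<lambda>_. 0), add = seq_add, smult = seq_scale\<rparr>"

text \<open>The scalar ring is the whole type \<open>'r\<close>. Homomorphisms preserve the identity,
  since \<open>ring_hom\<close> includes this.\<close>

definition algebra_hom :: "('r, 'a) module \<Rightarrow> ('r, 'b) module \<Rightarrow> ('a \<Rightarrow> 'b) set" where
  "algebra_hom A B =
     {f \<in> ring_hom A B. \<forall>r. \<forall>x\<in>carrier A. f (r \<odot>\<^bsub>A\<^esub> x) = r \<odot>\<^bsub>B\<^esub> f x}"

lemma seq_one_in_linrec_seqs: "seq_one \<in> linrec_seqs"
  unfolding linrec_seqs_def seq_one_def
  by (auto intro!: exI[of _ "1::nat"] exI[of _ "\<lambda>_. 0"])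

lemma seq_conv_one: "seq_conv seq_one a = a" "seq_conv a seq_one = a"
proof -
  have "(\<Sum>i=0..n. a i * (if n - i = 0 then 1 else 0)) = (\<Sum>i=0..n. if i = n then a i else 0)"
    for n by (rule sum.cong) auto
  then show "seq_conv a seq_one = a" by (simp add: seq_conv_def seq_one_def)
  have "(\<Sum>i=0..n. (if i = 0 then 1 else 0) * a (n - i)) = (\<Sum>i=0..n. if i = 0 then a n else 0)"
    for n by (rule sum.cong) auto
  then show "seq_conv seq_one a = a" by (simp add: seq_conv_def seq_one_def)
qed

lemma seq_hurwitz_one: "seq_hurwitz seq_one a = a" "seq_hurwitz a seq_one = a"
proof -
  have "(\<Sum>i=0..n. of_nat (n choose i) * a i * (if n - i = 0 then 1 else 0))
      = (\<Sum>i=0..n. if i = n then a i else 0)"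
    for n by (rule sum.cong) auto
  then show "seq_hurwitz a seq_one = a" by (simp add: seq_hurwitz_def seq_one_def)
  have "(\<Sum>i=0..n. of_nat (n choose i) * (if i = 0 then 1 else 0) * a (n - i))
      = (\<Sum>i=0..n. if i = 0 then a n else 0)"
    for n by (rule sum.cong) auto
  then show "seq_hurwitz seq_one a = a" by (simp add: seq_hurwitz_def seq_one_def)
qed

end

theory Submission
  imports Defs "HOL-Computational_Algebra.Formal_Power_Series"
    "HOL-Computational_Algebra.Fraction_Field" "HOL-Library.Multiset"
begin

text \<open>Let \<open>t = (0, 1, 0, \<dots>)\<close> and \<open>b = \<psi> t\<close>. It suffices to find \<open>k > 0\<close> with \<open>\<psi> (t\<^sup>k)\<close> a
  scalar multiple of the identity. The shift \<open>D\<close> is a derivation of the Hurwitz product, so in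
  characteristic \<open>p > 0\<close> we have \<open>D (b\<^sup>p) = p b\<^sup>p\<^sup>-\<^sup>1 D b = 0\<close>, and \<open>k = p\<close> works.

  In characteristic zero \<open>k = 1\<close> works. The elements \<open>1 - t\<close> and \<open>1 + t\<close> have geometric inverses, so
  \<open>1 - b\<close> and \<open>1 + b\<close> are units of the Hurwitz algebra. Pass to exponential generating functions
  over the fraction field and let \<open>u\<close> be a unit, \<open>w = u'/u\<close>. The recurrence for \<open>u\<close> is a Riccati
  equation for \<open>w\<close>: \<open>w\<^sup>N\<close> is a polynomial of degree less than \<open>N\<close> in the derivatives of \<open>w\<close>. So the
  symbol of \<open>w\<close> in the ring graded by degree is nilpotent, and in characteristic zero so are the
  symbols of all derivatives of \<open>w\<close>. These span a finite-dimensional space, hence they generate a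
  finite-dimensional algebra. A finite-dimensional algebra of power series contains only constants,
  because the powers of a nonconstant \<open>w - w(0)\<close> have distinct orders. Thus \<open>u' = \<lambda> u\<close> with constant
  \<open>\<lambda>\<close>, and this for both \<open>1 - b\<close> and \<open>1 + b\<close> forces \<open>b\<close> to be constant.\<close>

unbundle fps_syntax

section \<open>Linear algebra of power series over the constants\<close>

interpretation fps: vector_space "\<lambda>c (f :: 'a::field fps). fps_const c * f"
  by unfold_locales (simp_all add: algebra_simps flip: fps_const_add fps_const_mult)

lemma fps_span_deriv:
  fixes A B :: "'a::field fps set"
  assumes "\<And>x. x \<in> A \<Longrightarrow> fps_deriv x \<in> fps.span B" and "a \<in> fps.span A"
  shows "fps_deriv a \<in> fps.span B"
  using assms(2)
  by (induction rule: fps.span_induct_alt) (auto intro: fps.span_add fps.span_scale fps.span_zero assms(1))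

lemma fps_span_mult:
  fixes A B :: "'a::field fps set"
  assumes AB: "\<And>x y. x \<in> A \<Longrightarrow> y \<in> B \<Longrightarrow> x * y \<in> fps.span C"
    and a: "a \<in> fps.span A" and b: "b \<in> fps.span B"
  shows "a * b \<in> fps.span C"
proof -
  have *: "x * b \<in> fps.span C" if x: "x \<in> A" for x
    using b
  proof (induction rule: fps.span_induct_alt)
    case base
    then show ?case by (simp add: fps.span_zero)
  next
    case (step c y z)
    have "x * (fps_const c * y + z) = fps_const c * (x * y) + x * z" by (simp add: algebra_simps)
    then show ?case using AB[OF x step(1)] step(2) by (simp only: fps.span_add fps.span_scale)
  qed
  show ?thesis
    using a
  proof (induction rule: fps.span_induct_alt)
    case base
    then show ?case by (simp add: fps.span_zero)
  next
    case (step c y z)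
    have "(fps_const c * y + z) * b = fps_const c * (y * b) + z * b" by (simp add: algebra_simps)
    then show ?case using *[OF step(1)] step(2) by (simp only: fps.span_add fps.span_scale)
  qed
qed

text \<open>In a vanishing combination take the term \<open>m\<close> of least order among those
  with nonzero coefficient. All other such terms have strictly larger order by injectivity, so the
  coefficient at the order of \<open>m\<close> comes from \<open>m\<close> alone and cannot
  vanish.\<close>

lemma fps_independent_if_inj_subdegree:
  fixes B :: "'a::field fps set"
  assumes inj: "inj_on subdegree B" and nz: "0 \<notin> B"
  shows "fps.independent B"
proof
  assume "fps.dependent B"
  then obtain T c v where T: "finite T" "T \<subseteq> B" "(\<Sum>v\<in>T. fps_const (c v) * v) = 0"
    and v: "v \<in> T" "c v \<noteq> 0"
    unfolding fps.dependent_explicit by blast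
  define S where "S = {v \<in> T. c v \<noteq> 0}"
  have "finite S" "S \<noteq> {}" using T(1) v by (auto simp: S_def)
  then obtain m where m: "m \<in> S" and le: "\<And>y. y \<in> S \<Longrightarrow> subdegree m \<le> subdegree y"
    using ex_min_if_finite[of "subdegree ` S"] by (metis arg_min_if_finite(1) arg_min_least)
  let ?d = "subdegree m"
  have "c y * y $ ?d = (if y = m then c m * m $ ?d else 0)" if "y \<in> T" for y
  proof (cases "y \<in> S \<and> y \<noteq> m")
    case True
    then have "subdegree y \<noteq> ?d"
      using inj m T(2) by (auto simp: S_def inj_on_def)
    then have "?d < subdegree y" using le True by (simp add: order.not_eq_order_implies_strict)
    then have "y $ ?d = 0" by (rule nth_less_subdegree_zero)
    moreover have "y \<noteq> m" using True by blast
    ultimately show ?thesis by (simp only: mult_zero_right if_False)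
  next
    case False
    then show ?thesis using that by (auto simp: S_def)
  qed
  then have "(\<Sum>y\<in>T. c y * y $ ?d) = (\<Sum>y\<in>T. if y = m then c m * m $ ?d else 0)"
    by (rule sum.cong[OF refl])
  also have "\<dots> = c m * m $ ?d" using T(1) m by (simp add: S_def)
  finally have "(\<Sum>y\<in>T. fps_const (c y) * y) $ ?d = c m * m $ ?d"
    by (simp add: fps_sum_nth)
  moreover have "m \<noteq> 0" using m T(2) nz by (auto simp: S_def)
  ultimately show False using T(3) m by (simp add: S_def)
qed

lemma constant_if_powers_in_finite_span:
  fixes w :: "'a::field fps"
  assumes "finite B" and pow: "\<And>k. (w - fps_const (w $ 0)) ^ k \<in> fps.span B"
  shows "w = fps_const (w $ 0)"
proof (rule ccontr)
  define y where "y = w - fps_const (w $ 0)"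
  assume "w \<noteq> fps_const (w $ 0)"
  then have "y \<noteq> 0" by (simp add: y_def)
  \<comment> \<open>Removing the constant term makes the order positive, so the orders of the powers
    of \<open>y\<close> form a strictly increasing sequence.\<close>
  then have pos: "subdegree y > 0" by (simp add: y_def subdegree_eq_0_iff neq0_conv[symmetric] del: neq0_conv)
  let ?P = "range (\<lambda>k. y ^ k)"
  have "inj_on subdegree ?P" using pos by (auto simp: inj_on_def)
  then have "fps.independent ?P"
    using \<open>y \<noteq> 0\<close> by (intro fps_independent_if_inj_subdegree) auto
  moreover have "?P \<subseteq> fps.span B" using pow by (auto simp: y_def)
  ultimately have "finite ?P" using fps.independent_span_bound[OF \<open>finite B\<close>] by blast
  moreover have "inj (\<lambda>k. y ^ k)"
  proof (rule injI)
    fix i j :: nat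
    assume "y ^ i = y ^ j"
    then have "i * subdegree y = j * subdegree y" by (metis subdegree_power)
    then show "i = j" using pos by simp
  qed
  ultimately show False using finite_imageD infinite_UNIV_nat by blast
qed

section \<open>The degree filtration of a finitely generated algebra of power series\<close>

text \<open>Multisets serve as formal commutative monomials and \<open>size\<close> as their degree.
  The set holds their values, so one series may arise in several degrees.\<close>

definition monomials :: "'a::comm_monoid_mult set \<Rightarrow> nat \<Rightarrow> 'a set" where
  "monomials G k = {prod_mset m | m. set_mset m \<subseteq> G \<and> size m \<le> k}"

definition degree_filt :: "'a::field fps set \<Rightarrow> nat \<Rightarrow> 'a fps set" where
  "degree_filt G k = fps.span (monomials G k)"

lemma finite_monomials:
  assumes "finite G"
  shows "finite (monomials G k)"
proof -
  have "monomials G k \<subseteq> prod_list ` {xs. set xs \<subseteq> G \<and> length xs \<le> k}"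
  proof
    fix x assume "x \<in> monomials G k"
    then obtain m where m: "x = prod_mset m" "set_mset m \<subseteq> G" "size m \<le> k"
      by (auto simp: monomials_def)
    obtain xs where xs: "m = mset xs" using ex_mset by metis
    then have "x = prod_list xs" using m(1) by (simp only: prod_mset_prod_list)
    moreover have "set xs \<subseteq> G" "length xs \<le> k" using m(2,3) by (simp_all add: xs)
    ultimately show "x \<in> prod_list ` {xs. set xs \<subseteq> G \<and> length xs \<le> k}" by blast
  qed
  then show ?thesis
    using finite_lists_length_le[OF \<open>finite G\<close>] finite_surj by blast
qed

lemma monomialsI: "set_mset m \<subseteq> G \<Longrightarrow> size m \<le> k \<Longrightarrow> prod_mset m \<in> monomials G k"
  by (auto simp: monomials_def)

lemma degree_filt_mono: "j \<le> k \<Longrightarrow> degree_filt G j \<subseteq> degree_filt G k"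
  unfolding degree_filt_def by (rule fps.span_mono) (force simp: monomials_def)

lemma degree_filt_add: "a \<in> degree_filt G k \<Longrightarrow> b \<in> degree_filt G k \<Longrightarrow> a + b \<in> degree_filt G k"
  and degree_filt_diff: "a \<in> degree_filt G k \<Longrightarrow> b \<in> degree_filt G k \<Longrightarrow> a - b \<in> degree_filt G k"
  and degree_filt_scale: "a \<in> degree_filt G k \<Longrightarrow> fps_const c * a \<in> degree_filt G k"
  and degree_filt_sum: "(\<And>i. i \<in> I \<Longrightarrow> f i \<in> degree_filt G k) \<Longrightarrow> sum f I \<in> degree_filt G k"
  and degree_filt_zero: "0 \<in> degree_filt G k"
  unfolding degree_filt_def
  by (auto intro: fps.span_add fps.span_diff fps.span_scale fps.span_sum fps.span_zero)

lemma one_in_degree_filt: "1 \<in> degree_filt G k"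
  unfolding degree_filt_def using monomialsI[of "{#}" G k] by (auto intro: fps.span_base)

lemma span_subset_degree_filt: "fps.span G \<subseteq> degree_filt G 1"
  unfolding degree_filt_def
proof (rule fps.span_mono)
  show "G \<subseteq> monomials G 1" using monomialsI[of "{#x#}" G 1 for x] by auto
qed

lemma degree_filt_mult:
  assumes "a \<in> degree_filt G j" "b \<in> degree_filt G k"
  shows "a * b \<in> degree_filt G (j + k)"
  using _ assms unfolding degree_filt_def
proof (rule fps_span_mult)
  fix x y assume "x \<in> monomials G j" "y \<in> monomials G k"
  then obtain m n where "x = prod_mset m" "set_mset m \<subseteq> G" "size m \<le> j"
      "y = prod_mset n" "set_mset n \<subseteq> G" "size n \<le> k"
    by (auto simp: monomials_def)
  then show "x * y \<in> fps.span (monomials G (j + k))"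
    using monomialsI[of "m + n" G "j + k"] by (auto intro: fps.span_base)
qed

lemma degree_filt_power:
  assumes "a \<in> degree_filt G j"
  shows "a ^ n \<in> degree_filt G (n * j)"
proof (induction n)
  case 0
  then show ?case by (simp add: one_in_degree_filt)
next
  case (Suc n)
  then show ?case using degree_filt_mult[OF assms Suc] by simp
qed

text \<open>By the Leibniz rule, differentiating a monomial replaces one factor at a time by a
  linear combination of generators, which does not raise the degree.\<close>

lemma degree_filt_deriv:
  assumes G: "\<And>g. g \<in> G \<Longrightarrow> fps_deriv g \<in> fps.span G" and a: "a \<in> degree_filt G k"
  shows "fps_deriv a \<in> degree_filt G k"
proof -
  have *: "fps_deriv (prod_mset m) \<in> degree_filt G (size m)" if "set_mset m \<subseteq> G" for m
    using that
  proof (induction m)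
    case empty
    then show ?case by (simp add: degree_filt_zero)
  next
    case (add x m)
    have "x \<in> degree_filt G 1" "fps_deriv x \<in> degree_filt G 1"
      using add.prems G[of x] span_subset_degree_filt[of G] fps.span_base[of x G] by auto
    moreover have "prod_mset m \<in> degree_filt G (size m)"
      using add.prems monomialsI[of m G "size m"] unfolding degree_filt_def by (auto intro: fps.span_base)
    moreover have "fps_deriv (prod_mset m) \<in> degree_filt G (size m)"
      using add by simp
    ultimately have "x * fps_deriv (prod_mset m) + fps_deriv x * prod_mset m
        \<in> degree_filt G (1 + size m)"
      by (intro degree_filt_add degree_filt_mult)
    then show ?case by simp
  qed
  have "fps_deriv x \<in> fps.span (monomials G k)" if "x \<in> monomials G k" for x
    using that * degree_filt_mono[of _ k G] by (force simp: monomials_def degree_filt_def)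
  then show ?thesis
    using a fps_span_deriv unfolding degree_filt_def by blast
qed

text \<open>This says that the symbol of \<open>x\<close> in the associated graded ring is nilpotent.\<close>

definition symbol_nilpotent :: "'a::field fps set \<Rightarrow> 'a fps \<Rightarrow> nat \<Rightarrow> bool" where
  "symbol_nilpotent G x N \<longleftrightarrow> N > 0 \<and> x ^ N \<in> degree_filt G (N - 1)"

text \<open>This allows one common exponent for finitely many generators.\<close>

lemma symbol_nilpotent_mono:
  assumes "symbol_nilpotent G x N" "N \<le> M" "x \<in> degree_filt G 1"
  shows "symbol_nilpotent G x M"
proof -
  have "x ^ N * x ^ (M - N) \<in> degree_filt G ((N - 1) + (M - N) * 1)"
    using assms by (intro degree_filt_mult degree_filt_power) (auto simp: symbol_nilpotent_def)
  moreover have "x ^ N * x ^ (M - N) = x ^ M" using assms(2) by (simp flip: power_add)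
  ultimately show ?thesis using assms by (simp add: symbol_nilpotent_def)
qed

text \<open>In characteristic zero the nilradical is stable under derivations: differentiating
  \<open>x\<^sup>N \<equiv> 0\<close> repeatedly trades each factor \<open>x\<close> for two factors \<open>x'\<close>.\<close>

lemma symbol_nilpotent_deriv:
  fixes x :: "'a::field fps"
  assumes char0: "\<And>n. n > 0 \<Longrightarrow> of_nat n \<noteq> (0::'a)"
    and G: "\<And>g. g \<in> G \<Longrightarrow> fps_deriv g \<in> fps.span G"
    and x: "x \<in> degree_filt G 1" and nil: "symbol_nilpotent G x N"
  shows "symbol_nilpotent G (fps_deriv x) (2 * N)"
proof -
  define y where "y = fps_deriv x"
  have y: "y \<in> degree_filt G 1"
    unfolding y_def using G x by (rule degree_filt_deriv)
  have Dy: "fps_deriv y \<in> degree_filt G 1"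
    using G y by (rule degree_filt_deriv)
  \<comment> \<open>The product has \<open>N + k\<close> factors of degree 1; the claim is that its
    degree drops by one. The case \<open>k = 0\<close> is the hypothesis and \<open>k = N\<close>
    the conclusion.\<close>
  have "x ^ (N - k) * y ^ (2 * k) \<in> degree_filt G (N + k - 1)" if "k \<le> N" for k
    using that
  proof (induction k)
    case 0
    then show ?case using nil by (simp add: symbol_nilpotent_def)
  next
    case (Suc k)
    obtain m where m: "N - k = Suc m" using Suc.prems by (metis Suc_diff_Suc Suc_le_lessD)
    let ?p = "x ^ Suc m * y ^ (2 * k)"
    have p: "?p \<in> degree_filt G (N + k - 1)" using Suc m by simp
    have "fps_deriv ?p * y \<in> degree_filt G (N + k - 1 + 1)"
      using p y G by (intro degree_filt_mult degree_filt_deriv) auto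
    moreover have "?p * fps_deriv y \<in> degree_filt G (N + k - 1 + 1)"
      using p Dy by (intro degree_filt_mult)
    \<comment> \<open>Besides the next product in the induction, only a multiple of
      \<open>?p * fps_deriv y\<close> appears, and its degree is already controlled by the induction
      hypothesis.\<close>
    moreover have "fps_deriv ?p * y = of_nat (Suc m) * (x ^ m * y ^ (2 * Suc k))
        + of_nat (2 * k) * (?p * fps_deriv y)"
    proof -
      have dx: "fps_deriv (x ^ Suc m) = of_nat (Suc m) * (x ^ m * y)"
        by (simp add: fps_deriv_power' y_def mult_ac del: of_nat_Suc power_Suc)
      have dy: "fps_deriv (y ^ (2 * k)) * y = of_nat (2 * k) * (y ^ (2 * k) * fps_deriv y)"
      proof (cases "k = 0")
        case False
        then have eq: "y ^ (2 * k - 1) * y = y ^ (2 * k)" by (intro power_minus_mult) simp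
        have "fps_deriv (y ^ (2 * k)) * y = of_nat (2 * k) * (y ^ (2 * k - 1) * y * fps_deriv y)"
          by (simp only: fps_deriv_power' mult_ac)
        then show ?thesis unfolding eq .
      qed simp
      have "fps_deriv ?p * y = x ^ Suc m * (fps_deriv (y ^ (2 * k)) * y)
          + fps_deriv (x ^ Suc m) * (y ^ (2 * k) * y)"
        by (simp only: fps_deriv_mult distrib_right mult.assoc)
      then show ?thesis
        unfolding dx dy by (simp add: mult_ac power2_eq_square del: of_nat_Suc)
    qed
    then have "of_nat (Suc m) * (x ^ m * y ^ (2 * Suc k))
        = fps_deriv ?p * y - fps_const (of_nat (2 * k)) * (?p * fps_deriv y)"
      by (simp only: fps_of_nat add_diff_cancel_right')
    ultimately have "of_nat (Suc m) * (x ^ m * y ^ (2 * Suc k)) \<in> degree_filt G (N + k)"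
      using nil by (auto simp: symbol_nilpotent_def intro!: degree_filt_diff degree_filt_scale)
    \<comment> \<open>Characteristic zero enters here, to divide by the exponent
      \<open>Suc m\<close>.\<close>
    from degree_filt_scale[OF this, of "inverse (of_nat (Suc m))"]
    have "x ^ m * y ^ (2 * Suc k) \<in> degree_filt G (N + k)"
      using char0[of "Suc m"]
      by (simp add: mult.assoc[symmetric] fps_of_nat[symmetric] del: of_nat_Suc)
    moreover have "m = N - Suc k" using m by simp
    ultimately show ?case by simp
  qed
  from this[of N] show ?thesis
    using nil by (simp add: symbol_nilpotent_def y_def mult_2)
qed

text \<open>Pigeonhole: a monomial of degree above \<open>card G * M\<close> contains some generator
  at least \<open>M\<close> times, and \<open>g ^ M\<close> can be rewritten in degree less than
  \<open>M\<close>. Thus large degrees add nothing new.\<close>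

lemma degree_filt_stabilizes:
  assumes "finite G" and nil: "\<And>g. g \<in> G \<Longrightarrow> \<exists>N. symbol_nilpotent G g N"
  obtains K where "\<And>k. degree_filt G k \<subseteq> degree_filt G K"
proof -
  from nil obtain N where N: "\<And>g. g \<in> G \<Longrightarrow> symbol_nilpotent G g (N g)" by metis
  define M where "M = (\<Sum>g\<in>G. N g)"
  have M: "symbol_nilpotent G g M" if "g \<in> G" for g
    using that \<open>finite G\<close> span_subset_degree_filt[of G] fps.span_base[of g G]
    by (intro symbol_nilpotent_mono[OF N]) (auto simp: M_def intro: member_le_sum)
  define K where "K = card G * M"
  have step: "degree_filt G (Suc k) \<subseteq> degree_filt G k" if "K \<le> k" for k
  proof -
    have "prod_mset m \<in> degree_filt G k" if m: "set_mset m \<subseteq> G" "size m \<le> Suc k" for m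
    proof (cases "size m \<le> k")
      case True
      then show ?thesis
        using m monomialsI[of m G k] by (auto simp: degree_filt_def intro: fps.span_base)
    next
      case False
      have "\<exists>g\<in>G. M \<le> count m g"
      proof (rule ccontr)
        assume "\<not> ?thesis"
        then have "(\<Sum>g\<in>set_mset m. count m g) \<le> (\<Sum>g\<in>G. M)"
          using m(1) \<open>finite G\<close> by (intro order.trans[OF sum_mono2[of G] sum_mono]) auto
        then have "size m \<le> K" by (simp add: size_multiset_overloaded_eq K_def)
        then show False using False \<open>K \<le> k\<close> by simp
      qed
      then obtain g where g: "g \<in> G" "replicate_mset M g \<subseteq># m"
        by (auto simp: count_le_replicate_mset_subset_eq)
      then obtain r where r: "m = replicate_mset M g + r" by (auto simp: mset_subset_eq_exists_conv)
      have "prod_mset r \<in> degree_filt G (size r)"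
        using m r monomialsI[of r G "size r"] by (auto simp: degree_filt_def intro: fps.span_base)
      then have "g ^ M * prod_mset r \<in> degree_filt G (M - 1 + size r)"
        using M[OF g(1)] by (intro degree_filt_mult) (auto simp: symbol_nilpotent_def)
      then have "prod_mset m \<in> degree_filt G (M - 1 + size r)"
        by (simp add: r)
      moreover have "M - 1 + size r \<le> k"
        using m(2) r M[OF g(1)] by (auto simp: symbol_nilpotent_def)
      ultimately show ?thesis using degree_filt_mono by blast
    qed
    then have "monomials G (Suc k) \<subseteq> degree_filt G k" by (auto simp: monomials_def)
    then show ?thesis
      unfolding degree_filt_def by (intro fps.span_minimal fps.subspace_span)
  qed
  have "degree_filt G (K + k) \<subseteq> degree_filt G K" for k
  proof (induction k)
    case (Suc k)
    then show ?case using step[of "K + k"] by simp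
  qed simp
  then have "degree_filt G k \<subseteq> degree_filt G K" for k
    using degree_filt_mono[of k "K + k" G] by auto
  then show ?thesis by (rule that)
qed

section \<open>Units among the C-finite power series\<close>

text \<open>A monic linear differential equation with constant coefficients. For exponential
  generating functions this is the linear recurrence, since differentiation acts as the
  shift.\<close>

definition deriv_finite :: "'a::field fps \<Rightarrow> bool" where
  "deriv_finite f \<longleftrightarrow> (\<exists>N c. (fps_deriv ^^ N) f = (\<Sum>i<N. fps_const (c i) * (fps_deriv ^^ i) f))"

lemma deriv_finite_span:
  assumes "deriv_finite f"
  obtains B where "finite B" "f \<in> fps.span B" "\<And>x. x \<in> fps.span B \<Longrightarrow> fps_deriv x \<in> fps.span B"
proof -
  obtain N c where N: "(fps_deriv ^^ N) f = (\<Sum>i<N. fps_const (c i) * (fps_deriv ^^ i) f)"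
    using assms by (auto simp: deriv_finite_def)
  let ?B = "(\<lambda>i. (fps_deriv ^^ i) f) ` {..<N}"
  have top: "(fps_deriv ^^ i) f \<in> fps.span ?B" if "i \<le> N" for i
  proof (cases "i = N")
    case True
    then show ?thesis
      unfolding True N by (auto intro!: fps.span_sum fps.span_scale intro: fps.span_base)
  next
    case False
    then show ?thesis using that by (auto intro: fps.span_base)
  qed
  show ?thesis
  proof (rule that[of ?B])
    show "f \<in> fps.span ?B" using top[of 0] by simp
    fix x assume "x \<in> fps.span ?B"
    moreover have "fps_deriv y \<in> fps.span ?B" if "y \<in> ?B" for y
      using that top[of "Suc i" for i] by auto
    ultimately show "fps_deriv x \<in> fps.span ?B" using fps_span_deriv by blast
  qed auto
qed

lemma unit_log_deriv_constant:
  fixes u v :: "'a::field fps"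
  assumes char0: "\<And>n. n > 0 \<Longrightarrow> of_nat n \<noteq> (0::'a)"
    and u: "deriv_finite u" and v: "deriv_finite v" and uv: "u * v = 1"
  obtains c where "fps_deriv u = fps_const c * u"
proof -
  define w where "w = fps_deriv u * v"
  have wu: "w * u = fps_deriv u" using uv by (simp add: w_def mult.assoc mult.commute[of v])
  obtain A where A: "finite A" "u \<in> fps.span A" "\<And>x. x \<in> fps.span A \<Longrightarrow> fps_deriv x \<in> fps.span A"
    using deriv_finite_span[OF u] by blast
  obtain B where B: "finite B" "v \<in> fps.span B" "\<And>x. x \<in> fps.span B \<Longrightarrow> fps_deriv x \<in> fps.span B"
    using deriv_finite_span[OF v] by blast
  \<comment> \<open>Since \<open>w = fps_deriv u * v\<close>, the pairwise products span a
    finite-dimensional space that contains \<open>w\<close> and is closed under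
    differentiation.\<close>
  define C where "C = (\<lambda>(a, b). a * b) ` (A \<times> B)"
  have "finite C" using A B by (simp add: C_def)
  have AB: "a * b \<in> fps.span C" if "a \<in> fps.span A" "b \<in> fps.span B" for a b
    using _ that by (rule fps_span_mult) (auto simp: C_def intro: fps.span_base)
  have C_deriv: "fps_deriv x \<in> fps.span C" if "x \<in> fps.span C" for x
    using _ that
  proof (rule fps_span_deriv)
    fix x assume "x \<in> C"
    then obtain a b where "x = a * b" "a \<in> fps.span A" "b \<in> fps.span B"
      by (auto simp: C_def intro: fps.span_base)
    then show "fps_deriv x \<in> fps.span C" using A B AB by (simp add: fps.span_add)
  qed
  define W where "W = range (\<lambda>i. (fps_deriv ^^ i) w)"
  have W_deriv: "fps_deriv x \<in> W" if "x \<in> W" for x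
    using that unfolding W_def by (auto intro: range_eqI[of _ _ "Suc i" for i])
  have "(fps_deriv ^^ i) w \<in> fps.span C" for i
    by (induction i) (auto simp: w_def intro: AB A B C_deriv)
  then have WC: "W \<subseteq> fps.span C" by (auto simp: W_def)
  \<comment> \<open>The basis is chosen among the derivatives of \<open>w\<close> themselves, so
    that nilpotency of their symbols covers every generator.\<close>
  obtain G where G: "G \<subseteq> W" "fps.independent G" "W \<subseteq> fps.span G"
    using fps.maximal_independent_subset by blast
  have "finite G" using fps.independent_span_bound[OF \<open>finite C\<close> G(2)] G(1) WC by blast
  have G_deriv: "fps_deriv g \<in> fps.span G" if "g \<in> G" for g
    using that G W_deriv by blast
  have W1: "x \<in> degree_filt G 1" if "x \<in> W" for x
    using that G(3) span_subset_degree_filt by blast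
  have w1: "w \<in> degree_filt G 1"
    by (rule W1) (auto simp: W_def intro: range_eqI[of _ _ 0])
  \<comment> \<open>\<open>P k\<close> is the quotient of the \<open>k\<close>-th derivative of
    \<open>u\<close> by \<open>u\<close>. It is a differential polynomial in \<open>w\<close> of
    degree \<open>k\<close> with leading term \<open>w ^ k\<close>.\<close>
  define P where "P k = (fps_deriv ^^ k) u * v" for k
  have Pu: "P k * u = (fps_deriv ^^ k) u" for k
    using uv by (simp add: P_def mult.assoc mult.commute[of v])
  have P_Suc: "P (Suc k) = fps_deriv (P k) + w * P k" for k
  proof -
    have "fps_deriv (P k * u) = (fps_deriv (P k) + w * P k) * u"
      by (simp add: wu[symmetric] algebra_simps)
    then have "P (Suc k) * u = (fps_deriv (P k) + w * P k) * u"
      by (simp add: Pu)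
    then show ?thesis using uv by (metis mult_cancel_right mult_zero_left zero_neq_one)
  qed
  have P_filt: "P k \<in> degree_filt G k" for k
  proof (induction k)
    case 0
    then show ?case using uv by (simp add: P_def one_in_degree_filt)
  next
    case (Suc k)
    have "fps_deriv (P k) \<in> degree_filt G (Suc k)"
      using degree_filt_deriv[OF G_deriv Suc] degree_filt_mono[of k "Suc k" G] by auto
    then show ?case using degree_filt_mult[OF w1 Suc] by (simp add: P_Suc degree_filt_add)
  qed
  have P_lead: "P (Suc k) - w ^ Suc k \<in> degree_filt G k" for k
  proof (induction k)
    case 0
    then show ?case using P_Suc[of 0] uv by (simp add: P_def degree_filt_zero)
  next
    case (Suc k)
    have "P (Suc (Suc k)) - w ^ Suc (Suc k) = fps_deriv (P (Suc k)) + w * (P (Suc k) - w ^ Suc k)"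
      by (simp only: P_Suc[of "Suc k"]) (simp add: algebra_simps)
    then show ?case
      using degree_filt_deriv[OF G_deriv P_filt] degree_filt_mult[OF w1 Suc]
      by (simp add: degree_filt_add)
  qed
  obtain N c where N: "(fps_deriv ^^ N) u = (\<Sum>i<N. fps_const (c i) * (fps_deriv ^^ i) u)"
    using u by (auto simp: deriv_finite_def)
  have "u \<noteq> 0" using uv by auto
  \<comment> \<open>For \<open>N = 0\<close> the sum is empty and \<open>u\<close> would vanish;
    hence \<open>N - 1\<close> below is a true predecessor.\<close>
  then have "N \<noteq> 0" using N by (intro notI) simp
  then obtain n where n: "N = Suc n" by (auto simp: gr0_conv_Suc)
  \<comment> \<open>Dividing the differential equation of \<open>u\<close> by \<open>u\<close> gives
    the Riccati equation. Its right side has degree less than \<open>N\<close>, so the leading term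
    \<open>w ^ N\<close> of \<open>P N\<close> does too.\<close>
  have "P N = (\<Sum>i<N. fps_const (c i) * P i)"
    unfolding P_def N by (simp add: sum_distrib_right mult.assoc)
  also have "\<dots> \<in> degree_filt G n"
    using P_filt degree_filt_mono[of _ n G]
    by (intro degree_filt_sum degree_filt_scale) (auto simp: n less_Suc_eq_le)
  finally have "P N - (P N - w ^ N) \<in> degree_filt G n"
    using P_lead[of n] unfolding n by (rule degree_filt_diff)
  then have w_nil: "symbol_nilpotent G w N" by (simp add: symbol_nilpotent_def n)
  have "\<exists>N. symbol_nilpotent G ((fps_deriv ^^ i) w) N" for i
  proof (induction i)
    case 0
    then show ?case using w_nil by auto
  next
    case (Suc i)
    then obtain M where "symbol_nilpotent G ((fps_deriv ^^ i) w) M" by blast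
    then have "symbol_nilpotent G (fps_deriv ((fps_deriv ^^ i) w)) (2 * M)"
      by (intro symbol_nilpotent_deriv char0 G_deriv W1) (auto simp: W_def)
    then show ?case by auto
  qed
  then have "\<exists>N. symbol_nilpotent G g N" if "g \<in> G" for g
    using that G(1) by (auto simp: W_def)
  from degree_filt_stabilizes[OF \<open>finite G\<close> this] obtain K
    where K: "\<And>k. degree_filt G k \<subseteq> degree_filt G K" by blast
  have "w - fps_const (w $ 0) \<in> degree_filt G 1"
    using degree_filt_diff[OF w1 degree_filt_scale[OF one_in_degree_filt]] by (metis mult.right_neutral)
  from degree_filt_power[OF this] have "(w - fps_const (w $ 0)) ^ k \<in> degree_filt G K" for k
    using K by blast
  then have "w = fps_const (w $ 0)"
    unfolding degree_filt_def
    using constant_if_powers_in_finite_span finite_monomials[OF \<open>finite G\<close>] by blast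
  then show ?thesis using wu that by metis
qed

section \<open>The Hurwitz product\<close>

definition seq_shift :: "(nat \<Rightarrow> 'a) \<Rightarrow> nat \<Rightarrow> 'a" where
  "seq_shift a = (\<lambda>n. a (Suc n))"

text \<open>In the convolution algebra this is the \<open>k\<close>-th power of
  \<open>t\<close>.\<close>

definition seq_unit :: "nat \<Rightarrow> nat \<Rightarrow> 'a::comm_ring_1" where
  "seq_unit k = (\<lambda>n. if n = k then 1 else 0)"

lemma seq_add_apply: "seq_add a b n = a n + b n"
  by (simp add: seq_add_def)

text \<open>Pascal's rule splits the sum. This Leibniz rule for the shift reduces an entry at
  \<open>Suc n\<close> to entries at \<open>n\<close> of products of shifted sequences, so
  commutativity and associativity follow by induction on the index.\<close>

lemma seq_hurwitz_Suc:
  "seq_hurwitz a b (Suc n) = seq_hurwitz (seq_shift a) b n + seq_hurwitz a (seq_shift b) n"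
proof -
  have "seq_hurwitz a (seq_shift b) n
      = (\<Sum>i=0..n. of_nat (n choose i) * a i * b (Suc n - i))"
    unfolding seq_hurwitz_def seq_shift_def by (rule sum.cong) (auto simp: Suc_diff_le)
  also have "\<dots> = (\<Sum>i=0..Suc n. of_nat (n choose i) * a i * b (Suc n - i))"
    by (simp add: binomial_eq_0)
  also have "\<dots> = a 0 * b (Suc n) + (\<Sum>i=0..n. of_nat (n choose Suc i) * a (Suc i) * b (n - i))"
    by (subst sum.atLeast0_atMost_Suc_shift) simp
  finally have *: "seq_hurwitz a (seq_shift b) n = \<dots>" .
  have "seq_hurwitz a b (Suc n)
      = a 0 * b (Suc n) + (\<Sum>i=0..n. of_nat (Suc n choose Suc i) * a (Suc i) * b (n - i))"
    unfolding seq_hurwitz_def by (subst sum.atLeast0_atMost_Suc_shift) simp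
  then show ?thesis
    unfolding * by (simp add: seq_hurwitz_def seq_shift_def sum.distrib distrib_right)
qed

lemma seq_hurwitz_0: "seq_hurwitz a b 0 = a 0 * b 0"
  by (simp add: seq_hurwitz_def)

lemma seq_shift_hurwitz:
  "seq_shift (seq_hurwitz a b) = seq_add (seq_hurwitz (seq_shift a) b) (seq_hurwitz a (seq_shift b))"
  by (simp add: fun_eq_iff seq_shift_def[of "seq_hurwitz a b"] seq_hurwitz_Suc seq_add_def)

lemma seq_hurwitz_add_left: "seq_hurwitz (seq_add a b) c = seq_add (seq_hurwitz a c) (seq_hurwitz b c)"
  and seq_hurwitz_add_right: "seq_hurwitz c (seq_add a b) = seq_add (seq_hurwitz c a) (seq_hurwitz c b)"
  and seq_hurwitz_scale_right: "seq_hurwitz c (seq_scale r a) = seq_scale r (seq_hurwitz c a)"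
  by (auto simp: fun_eq_iff seq_hurwitz_def seq_add_def seq_scale_def sum_distrib_left
      algebra_simps sum.distrib[symmetric] intro!: sum.cong)

lemma seq_hurwitz_commute: "seq_hurwitz a b = seq_hurwitz b a"
proof
  fix n
  show "seq_hurwitz a b n = seq_hurwitz b a n"
    by (induction n arbitrary: a b) (simp_all add: seq_hurwitz_0 seq_hurwitz_Suc mult.commute add.commute)
qed

lemma seq_hurwitz_assoc:
  "seq_hurwitz (seq_hurwitz a b) c = seq_hurwitz a (seq_hurwitz b c)"
proof
  fix n
  show "seq_hurwitz (seq_hurwitz a b) c n = seq_hurwitz a (seq_hurwitz b c) n"
  proof (induction n arbitrary: a b c)
    case 0
    then show ?case by (simp add: seq_hurwitz_0 mult.assoc)
  next
    case (Suc n)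
    then show ?case
      by (simp add: seq_hurwitz_Suc seq_shift_hurwitz seq_hurwitz_add_left seq_hurwitz_add_right seq_add_apply)
  qed
qed

primrec hurwitz_power :: "(nat \<Rightarrow> 'a::comm_ring_1) \<Rightarrow> nat \<Rightarrow> nat \<Rightarrow> 'a" where
  "hurwitz_power a 0 = seq_one"
| "hurwitz_power a (Suc k) = seq_hurwitz a (hurwitz_power a k)"

lemma seq_shift_hurwitz_power:
  "seq_shift (hurwitz_power a (Suc k))
    = seq_scale (of_nat (Suc k)) (seq_hurwitz (hurwitz_power a k) (seq_shift a))"
proof (induction k)
  case 0
  then show ?case
    by (simp add: seq_hurwitz_one) (simp add: seq_scale_def)
next
  case (Suc k)
  let ?p = "hurwitz_power a k"
  have "seq_shift (hurwitz_power a (Suc (Suc k)))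
      = seq_add (seq_hurwitz (hurwitz_power a (Suc k)) (seq_shift a))
          (seq_hurwitz a (seq_scale (of_nat (Suc k)) (seq_hurwitz ?p (seq_shift a))))"
    unfolding hurwitz_power.simps(2)[of a "Suc k"] seq_shift_hurwitz Suc
    by (simp only: seq_hurwitz_commute[of "seq_shift a"])
  also have "\<dots> = seq_add (seq_hurwitz (hurwitz_power a (Suc k)) (seq_shift a))
          (seq_scale (of_nat (Suc k)) (seq_hurwitz (hurwitz_power a (Suc k)) (seq_shift a)))"
    by (simp only: seq_hurwitz_scale_right seq_hurwitz_assoc hurwitz_power.simps)
  finally show ?case
    by (simp add: fun_eq_iff seq_add_def seq_scale_def algebra_simps)
qed

text \<open>The power rule puts a factor \<open>p = 0\<close> in front of the shift of the power, so
  every entry after the first vanishes.\<close>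

lemma hurwitz_power_char:
  assumes "of_nat p = (0::'a::comm_ring_1)" "p > 0"
  shows "hurwitz_power a p = seq_scale (hurwitz_power a p 0) (seq_one :: nat \<Rightarrow> 'a)"
proof
  fix n
  obtain k where p: "p = Suc k" using assms(2) by (auto simp: gr0_conv_Suc)
  have "seq_shift (hurwitz_power a p) m = 0" for m
    using assms(1) unfolding p seq_shift_hurwitz_power by (simp add: seq_scale_def)
  then show "hurwitz_power a p n = seq_scale (hurwitz_power a p 0) seq_one n"
    by (cases n) (simp_all add: seq_scale_def seq_one_def seq_shift_def)
qed

section \<open>Exponential generating functions\<close>

text \<open>Factorials must be divided out, hence the fraction field. If a factorial is zero in the
  field, division returns 0, so the product and shift rules are proved under the characteristic-zero
  assumption of the context below.\<close>

definition egf :: "(nat \<Rightarrow> 'a::idom) \<Rightarrow> 'a fract fps" where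
  "egf a = Abs_fps (\<lambda>n. Fract (a n) 1 / of_nat (fact n))"

lemma of_nat_fract_nonzero:
  assumes "\<And>n. n > 0 \<Longrightarrow> of_nat n \<noteq> (0::'a::idom)" "n > 0"
  shows "of_nat n \<noteq> (0 :: 'a fract)"
  using assms by (simp add: of_nat_fract Zero_fract_def eq_fract)

lemma Fract_sum: "Fract (sum f A) 1 = (\<Sum>x\<in>A. Fract (f x) 1)"
proof (induction A rule: infinite_finite_induct)
  case (insert x F)
  have "Fract (f x + sum f F) 1 = Fract (f x) 1 + Fract (sum f F) 1" by simp
  then show ?case using insert by simp
qed (simp_all add: Zero_fract_def)

lemma egf_one: "egf seq_one = 1"
  by (rule fps_ext) (simp add: egf_def seq_one_def Zero_fract_def[symmetric] One_fract_def[symmetric])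

lemma egf_add: "egf (seq_add a b) = egf a + egf b"
proof (rule fps_ext)
  fix n
  have "Fract (a n + b n) 1 = Fract (a n) 1 + Fract (b n) 1" by simp
  then show "egf (seq_add a b) $ n = (egf a + egf b) $ n"
    by (simp only: egf_def seq_add_def fps_nth_Abs_fps fps_add_nth add_divide_distrib)
qed

lemma egf_uminus: "egf (seq_scale (-1) a) = - egf a"
  by (rule fps_ext) (simp add: egf_def seq_scale_def flip: minus_fract)

context
  assumes char0: "\<And>n. n > 0 \<Longrightarrow> of_nat n \<noteq> (0::'a::idom)"
begin

lemma of_nat_fact_fract_nonzero: "of_nat (fact n) \<noteq> (0::'a fract)"
  by (rule of_nat_fract_nonzero[OF char0]) auto

text \<open>The factorial weights absorb the binomial coefficient: \<open>n choose i\<close> over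
  \<open>fact n\<close> is the inverse of \<open>fact i * fact (n - i)\<close>.\<close>

lemma egf_hurwitz: "egf (seq_hurwitz a b) = egf a * (egf b :: 'a fract fps)"
proof (rule fps_ext)
  fix n
  have "Fract (of_nat (n choose i) * a i * b (n - i)) 1 / of_nat (fact n)
      = (Fract (a i) 1 / of_nat (fact i)) * (Fract (b (n - i)) 1 / (of_nat (fact (n - i)) :: 'a fract))"
    if "i \<le> n" for i
  proof -
    have 1: "of_nat (fact n) = of_nat (fact i) * of_nat (fact (n - i)) * (of_nat (n choose i) :: 'a fract)"
      using binomial_fact_lemma[OF that] by (metis of_nat_mult)
    have 2: "Fract (of_nat (n choose i) * a i * b (n - i)) 1
        = of_nat (n choose i) * Fract (a i) 1 * Fract (b (n - i)) 1"
      by (simp add: of_nat_fract)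
    have "of_nat (n choose i) \<noteq> (0 :: 'a fract)"
      using 1 of_nat_fact_fract_nonzero[of n] by auto
    then show ?thesis
      unfolding 1 2 by (simp add: mult_ac del: mult_fract)
  qed
  then have "(\<Sum>i=0..n. Fract (of_nat (n choose i) * a i * b (n - i)) 1 / of_nat (fact n))
      = (\<Sum>i=0..n. (Fract (a i) 1 / of_nat (fact i))
          * (Fract (b (n - i)) 1 / (of_nat (fact (n - i)) :: 'a fract)))"
    by (intro sum.cong) auto
  then show "egf (seq_hurwitz a b) $ n = (egf a * egf b :: 'a fract fps) $ n"
    by (simp only: egf_def seq_hurwitz_def fps_nth_Abs_fps fps_mult_nth Fract_sum sum_divide_distrib)
qed

lemma egf_shift: "fps_deriv (egf a) = (egf (\<lambda>n. a (Suc n)) :: 'a fract fps)"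
proof (rule fps_ext)
  fix n
  have "of_nat (Suc n) \<noteq> (0::'a fract)" by (rule of_nat_fract_nonzero[OF char0]) auto
  then show "fps_deriv (egf a) $ n = (egf (\<lambda>n. a (Suc n)) :: 'a fract fps) $ n"
    by (simp add: egf_def del: of_nat_Suc mult_Suc)
qed

lemma egf_funpow_shift: "(fps_deriv ^^ k) (egf a) = (egf (\<lambda>n. a (n + k)) :: 'a fract fps)"
  by (induction k) (simp_all add: egf_shift)

lemma deriv_finite_egf:
  assumes "(a :: nat \<Rightarrow> 'a) \<in> linrec_seqs"
  shows "deriv_finite (egf a)"
proof -
  obtain N h where rec: "\<And>n. n \<ge> N \<Longrightarrow> a n = (\<Sum>i=1..N. h i * a (n - i))"
    using assms by (auto simp: linrec_seqs_def)
  \<comment> \<open>Reading the recurrence at index \<open>n + N\<close> reverses the order of its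
    coefficients, whence \<open>h (N - i)\<close>.\<close>
  have "(fps_deriv ^^ N) (egf a) = (\<Sum>i<N. fps_const (Fract (h (N - i)) 1) * (fps_deriv ^^ i) (egf a))"
  proof (rule fps_ext)
    fix n
    have "a (n + N) = (\<Sum>i=1..N. h i * a (n + N - i))" by (rule rec) simp
    also have "\<dots> = (\<Sum>i<N. h (N - i) * a (n + i))"
      by (rule sum.reindex_bij_witness[of _ "\<lambda>i. N - i" "\<lambda>i. N - i"]) auto
    finally have "Fract (a (n + N)) 1 = (\<Sum>i<N. Fract (h (N - i)) 1 * Fract (a (n + i)) 1)"
      by (simp add: Fract_sum)
    then show "(fps_deriv ^^ N) (egf a) $ n
        = (\<Sum>i<N. fps_const (Fract (h (N - i)) 1) * (fps_deriv ^^ i) (egf a)) $ n"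
      unfolding egf_funpow_shift
      by (simp add: egf_def fps_sum_nth sum_divide_distrib del: mult_fract)
  qed
  then show ?thesis unfolding deriv_finite_def by (intro exI)
qed

lemma hurwitz_unit_egf_deriv:
  assumes "u \<in> linrec_seqs" "v \<in> linrec_seqs" "seq_hurwitz u v = (seq_one :: nat \<Rightarrow> 'a)"
  obtains c where "fps_deriv (egf u) = fps_const c * egf u"
  using unit_log_deriv_constant[OF of_nat_fract_nonzero[OF char0] deriv_finite_egf[OF assms(1)]
      deriv_finite_egf[OF assms(2)]] assms(3)
  by (metis egf_hurwitz egf_one)

text \<open>With \<open>f = egf b\<close>, the two units give \<open>f' = c (1 + f)\<close> and
  \<open>- f' = d (1 - f)\<close>; adding them yields \<open>(d - c) f = c + d\<close>. If
  \<open>c\<close> and \<open>d\<close> differ, \<open>f\<close> is constant. Otherwise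
  \<open>2 c = 0\<close>, so \<open>c = 0\<close> and \<open>f' = 0\<close>.\<close>

lemma scalar_if_hurwitz_units:
  fixes b :: "nat \<Rightarrow> 'a"
  assumes "seq_add seq_one b \<in> linrec_seqs" "v \<in> linrec_seqs"
    and "seq_hurwitz (seq_add seq_one b) v = seq_one"
    and "seq_add seq_one (seq_scale (-1) b) \<in> linrec_seqs" "v' \<in> linrec_seqs"
    and "seq_hurwitz (seq_add seq_one (seq_scale (-1) b)) v' = seq_one"
  shows "b = seq_scale (b 0) seq_one"
proof
  fix n
  obtain c where c: "fps_deriv (egf b) = fps_const c * (1 + egf b)"
    using hurwitz_unit_egf_deriv[OF assms(1-3)] by (auto simp: egf_add egf_one)
  obtain d where d: "- fps_deriv (egf b) = fps_const d * (1 - egf b)"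
    using hurwitz_unit_egf_deriv[OF assms(4-6)] by (auto simp: egf_add egf_one egf_uminus)
  have "fps_const (d - c) * egf b = fps_const d - fps_const d * (1 - egf b) - fps_const c * egf b"
    by (simp add: algebra_simps flip: fps_const_sub)
  also have "\<dots> = fps_const (c + d)"
    by (simp only: d[symmetric] c) (simp add: algebra_simps flip: fps_const_add)
  finally have *: "fps_const (d - c) * egf b = fps_const (c + d)" .
  show "b n = seq_scale (b 0) seq_one n"
  proof (cases n)
    case 0
    then show ?thesis by (simp add: seq_scale_def seq_one_def)
  next
    case (Suc m)
    have "egf b $ Suc m = 0"
    proof (cases "c = d")
      case False
      have "(fps_const (d - c) * egf b) $ Suc m = 0" unfolding * by simp
      then show ?thesis using False by simp
    next
      case True
      then have "fps_const (c + c) = (0 :: 'a fract fps)" using * by simp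
      then have "c + c = 0" by (simp only: fps_const_eq_0_iff)
      then have "of_nat 2 * c = 0" by (simp only: of_nat_numeral mult_2)
      then have "c = 0"
        using of_nat_fract_nonzero[OF char0, of 2] by (simp only: mult_eq_0_iff) simp
      then have "fps_deriv (egf b) = 0" by (simp only: c fps_const_0_eq_0 mult_zero_left)
      then have "fps_deriv (egf b) $ m = 0" by (simp only: fps_zero_nth)
      then have "of_nat (Suc m) * egf b $ Suc m = 0"
        by (simp only: fps_deriv_nth Suc_eq_plus1)
      then show ?thesis using of_nat_fract_nonzero[OF char0, of "Suc m"]
        by (metis mult_eq_0_iff zero_less_Suc)
    qed
    then have "Fract (b n) 1 = 0"
      using of_nat_fact_fract_nonzero[of "Suc m"] Suc by (simp add: egf_def del: fact_Suc)
    then show ?thesis using Suc by (simp add: Zero_fract_def eq_fract seq_scale_def seq_one_def)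
  qed
qed

end

section \<open>Recurrent sequences and inverses in the convolution algebra\<close>

lemma seq_unit_linrec: "seq_unit k \<in> linrec_seqs"
  unfolding linrec_seqs_def seq_unit_def by (auto intro!: exI[of _ "Suc k"] exI[of _ "\<lambda>_. 0"])

lemma geometric_linrec: "(\<lambda>n. c ^ n) \<in> linrec_seqs"
  unfolding linrec_seqs_def
  by (auto intro!: exI[of _ "1::nat"] exI[of _ "\<lambda>_. c"] simp flip: power_Suc)

lemma one_add_scale_unit_linrec: "seq_add seq_one (seq_scale c (seq_unit 1)) \<in> linrec_seqs"
  unfolding linrec_seqs_def seq_unit_def seq_add_def seq_scale_def seq_one_def
  by (auto intro!: exI[of _ "2::nat"] exI[of _ "\<lambda>_. 0"])

lemma scale_linrec:
  assumes "a \<in> linrec_seqs"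
  shows "seq_scale c a \<in> linrec_seqs"
proof -
  obtain N h where "\<And>n. n \<ge> N \<Longrightarrow> a n = (\<Sum>i=1..N. h i * a (n - i))"
    using assms by (auto simp: linrec_seqs_def)
  then have "\<forall>n\<ge>N. c * a n = (\<Sum>i=1..N. h i * (c * a (n - i)))"
    by (simp add: sum_distrib_left mult.left_commute)
  then show ?thesis unfolding linrec_seqs_def seq_scale_def by blast
qed

lemma seq_conv_unit_1: "seq_conv (seq_unit 1) a n = (if n = 0 then 0 else a (n - 1))"
proof -
  have "seq_conv (seq_unit 1) a n = (\<Sum>i=0..n. if i = 1 then a (n - 1) else 0)"
    unfolding seq_conv_def seq_unit_def by (rule sum.cong) auto
  then show ?thesis by auto
qed

lemma seq_conv_unit_Suc: "seq_conv (seq_unit 1) (seq_unit k) = seq_unit (Suc k)"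
proof
  fix n
  show "seq_conv (seq_unit 1) (seq_unit k) n = seq_unit (Suc k) n"
    unfolding seq_conv_unit_1 by (cases n) (simp_all add: seq_unit_def)
qed

text \<open>This is the geometric series for the inverse of \<open>1 - c t\<close>; the values
  \<open>c = 1\<close> and \<open>c = -1\<close> supply the two units.\<close>

lemma seq_conv_geometric:
  "seq_conv (seq_add seq_one (seq_scale (-c) (seq_unit 1))) (\<lambda>n. c ^ n) = seq_one"
proof
  fix n
  have "seq_conv (seq_add seq_one (seq_scale (-c) (seq_unit 1))) (\<lambda>n. c ^ n) n
      = seq_conv seq_one (\<lambda>n. c ^ n) n - c * seq_conv (seq_unit 1) (\<lambda>n. c ^ n) n"
    unfolding seq_conv_def seq_add_def seq_scale_def
    by (simp add: algebra_simps sum.distrib sum_subtractf sum_distrib_left)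
  then show "seq_conv (seq_add seq_one (seq_scale (-c) (seq_unit 1))) (\<lambda>n. c ^ n) n = seq_one n"
    unfolding seq_conv_one seq_conv_unit_1 by (cases n) (simp_all add: seq_one_def)
qed

section \<open>Non-injectivity, by cases on the characteristic\<close>

theorem theorem14:
  fixes \<psi> :: "(nat \<Rightarrow> 'a::idom) \<Rightarrow> (nat \<Rightarrow> 'a)"
  assumes "\<psi> \<in> algebra_hom linrec_conv_algebra linrec_hurwitz_algebra"
  shows "\<not> inj_on \<psi> (carrier linrec_conv_algebra)"
proof
  assume "inj_on \<psi> (carrier linrec_conv_algebra)"
  then have inj: "inj_on \<psi> linrec_seqs" by (simp add: linrec_conv_algebra_def)
  have closed: "\<psi> x \<in> linrec_seqs"
    and scale: "\<psi> (seq_scale r x) = seq_scale r (\<psi> x)"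
    if "x \<in> linrec_seqs" for x r
    using assms that
    by (auto simp: algebra_hom_def ring_hom_def linrec_conv_algebra_def linrec_hurwitz_algebra_def)
  have mult: "\<psi> (seq_conv x y) = seq_hurwitz (\<psi> x) (\<psi> y)"
    and add: "\<psi> (seq_add x y) = seq_add (\<psi> x) (\<psi> y)"
    if "x \<in> linrec_seqs" "y \<in> linrec_seqs" for x y
    using assms that
    by (auto simp: algebra_hom_def ring_hom_def linrec_conv_algebra_def linrec_hurwitz_algebra_def)
  have one: "\<psi> seq_one = seq_one"
    using assms
    by (auto simp: algebra_hom_def ring_hom_def linrec_conv_algebra_def linrec_hurwitz_algebra_def)
  \<comment> \<open>A power of \<open>t\<close> with scalar image shares that image with the scalar
    \<open>c\<close> itself. Injectivity would identify the two, but for \<open>k > 0\<close> they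
    differ at index \<open>k\<close>.\<close>
  have scalar: False if "\<psi> (seq_unit k) = seq_scale c seq_one" "k > 0" for k c
  proof -
    have "\<psi> (seq_unit k) = \<psi> (seq_scale c seq_one)"
      using that(1) scale[OF seq_one_in_linrec_seqs] one by simp
    then have "seq_unit k = seq_scale c (seq_one :: nat \<Rightarrow> 'a)"
      by (rule inj_onD[OF inj _ seq_unit_linrec scale_linrec[OF seq_one_in_linrec_seqs]])
    then have "seq_unit k k = seq_scale c (seq_one :: nat \<Rightarrow> 'a) k" by simp
    then show False using \<open>k > 0\<close> by (simp add: seq_unit_def seq_scale_def seq_one_def)
  qed
  define b where "b = \<psi> (seq_unit 1)"
  show False
  proof (cases "\<exists>p>0. of_nat p = (0::'a)")
    case True
    then obtain p where p: "of_nat p = (0::'a)" "p > 0" by blast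
    have "\<psi> (seq_unit k) = hurwitz_power b k" for k
    proof (induction k)
      case 0
      then show ?case using one by (simp add: seq_unit_def seq_one_def)
    next
      case (Suc k)
      have "\<psi> (seq_unit (Suc k)) = seq_hurwitz b (\<psi> (seq_unit k))"
        unfolding b_def seq_conv_unit_Suc[symmetric] by (rule mult) (rule seq_unit_linrec)+
      then show ?case using Suc by simp
    qed
    then show False using hurwitz_power_char[OF p, of b] scalar p(2) by metis
  next
    case False
    have \<psi>_factor: "\<psi> (seq_add seq_one (seq_scale c (seq_unit 1))) = seq_add seq_one (seq_scale c b)"
      for c
      unfolding b_def
      by (simp only: add scale scale_linrec seq_unit_linrec seq_one_in_linrec_seqs one)
    \<comment> \<open>The image of \<open>1 - c t\<close> is \<open>1 - c b\<close>, and the image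
      of the geometric sequence is its Hurwitz inverse.\<close>
    have factor: "seq_add seq_one (seq_scale (-c) b) \<in> linrec_seqs"
        "seq_hurwitz (seq_add seq_one (seq_scale (-c) b)) (\<psi> (\<lambda>n. c ^ n)) = seq_one" for c
      using closed[OF one_add_scale_unit_linrec, of "-c"]
        mult[OF one_add_scale_unit_linrec geometric_linrec, of "-c" c]
      unfolding \<psi>_factor seq_conv_geometric one by auto
    have char0: "of_nat n \<noteq> (0::'a)" if "n > 0" for n using False that by blast
    have "seq_scale (- (- 1)) b = b" by (simp add: seq_scale_def)
    then have "seq_add seq_one b \<in> linrec_seqs"
        "seq_hurwitz (seq_add seq_one b) (\<psi> (\<lambda>n. (-1) ^ n)) = seq_one"
      using factor[of "-1"] by simp_all
    from scalar_if_hurwitz_units[OF char0 this(1) closed[OF geometric_linrec] this(2)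
        factor(1)[of 1] closed[OF geometric_linrec] factor(2)[of 1]]
    have "b = seq_scale (b 0) seq_one" .
    then show False using scalar[of 1] by (metis b_def zero_less_one)
  qed
qed

end
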